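(* Let $k$ be a field and order the free commutative semiring $Rig[x]$ on one generator $x$ by the ordering $<$ described in the context. Let $S$ consist of the following relations: 1. $x^4=1\circ1\circ x^2$, 2. $x\circ x^3=1\circ x^2$, 3. $1\circ x^2\circ x^n=x^n$ $(1\leq n\leq 3)$. Then $kRig[x\,|\,x=1\circ x\circ x^2]=kRig[x\,|\,S]$, and $S$ is a Gröbner-Shirshov basis in $kRig[x]$.
   Context: A commutative semiring $(A,\circ,\cdot,\theta,1)$ consists of two commutative monoids $(A,\circ,\theta)$ and $(A,\cdot,1)$ such that $\theta\cdot a=\theta$ for all $a$ and $\cdot$ distributes over $\circ$. $Rig[x]$ is the free commutative semiring on one generator $x$ (so $Rig[x]\cong\mathbb N[x]$ with $\circ$ as addition, $\theta$ as zero); with $[x]=\{x^n\mid n\ge0\}$, its elements (monomials) are the finite multisets $u_1\circ\cdots\circ u_n$ with $u_i\in[x]$, $n\ge0$ ($n=0$ gives $\theta$). $kRig[x]$ is the $k$-vector space with basis $Rig[x]$, with $\circ$ and $\cdot$ extended bilinearly. An ideal of $kRig[x]$ is an ideal with respect to both operations $\circ$ and $\cdot$; $Id(S)$ is the ideal generated by $S$, and $kRig[x|S]=kRig[x]/Id(S)$. A relation $u=v$ ($u,v\in Rig[x]$) is identified with the polynomial $u-v\in kRig[x]$. The equality $kRig[x|R]=kRig[x|S]$ means $Id(R)=Id(S)$. Ordering: order $[x]$ by $x^n\prec x^m\Leftrightarrow n<m$. For $u=u_1\circ\cdots\circ u_n\in Rig[x]$ with $u_i\in[x]$ and $u_1\preceq\cdots\preceq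 u_n$, let $wt(u)=(u_n,u_{n-1},\dots,u_1)$. For $u,v\in Rig[x]$: if neither of the sequences $wt(u),wt(v)$ is a prefix of the other, then $u<v$ iff $wt(u)<wt(v)$ lexicographically; if $wt(u)$ is a proper prefix of $wt(v)$, then $u<v$. This is a monomial ordering. For a nonzero polynomial $f$, $\bar f$ is its leading (largest) monomial; $f$ is monic if $\bar f$ has coefficient $1$. For monomials $u=w_1\circ\cdots\circ w_m\circ u_{m+1}\circ\cdots\circ u_n$ and $v=w_1\circ\cdots\circ w_m\circ v_{m+1}\circ\cdots\circ v_t$ with all $w_l,u_i,v_j\in[x]$ and $u_i\ne v_j$ for all $i,j>m$, put $lcm_\circ(u,v)=w_1\circ\cdots\circ w_m\circ u_{m+1}\circ\cdots\circ u_n\circ v_{m+1}\circ\cdots\circ v_t$. Compositions: let $f,g$ be monic with $\bar f=u_1\circ\cdots\circ u_n$, $\bar g=v_1\circ\cdots\circ v_m$, $u_i,v_j\in[x]$. For each pair $(i,j)$ let $a,b\in[x]$ be the elements such that $au_i=bv_j$ is the least common multiple of $u_i$ and $v_j$ in $[x]$. The corresponding composition is $(f,g)_w=af\circ u-bg\circ v$, where $w=lcm_\circ(a\bar f,b\bar g)=a\bar f\circ u=b\bar g\circ v$. For a set $S$ of monic polynomials and a monomial $w$, a polynomial $h$ is trivial modulo $(S,w)$ if $h=\sum_i\alpha_ia_is_i\circ u_i$ (finite sum) with $\alpha_i\in k$, $a_i\in[x]$, $u_i\in Rig[x]$, $s_i\in S$ and $a_i\overline{s_i}\circ u_i<w$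 for all $i$. $S$ is a Gröbner-Shirshov basis in $kRig[x]$ if every composition $(f,g)_w$ with $f,g\in S$ is trivial modulo $(S,w)$. *)

theory Defs
  imports "HOL-Library.Poly_Mapping" "HOL-Computational_Algebra.Polynomial"
begin

(* Rig[x] is the commutative semiring "nat poly": circ is addition, with unit theta = 0,
   and cdot is multiplication, with unit 1. A monomial u_1 circ ... circ u_n is the sum of the
   powers X^e_1, ..., X^e_n, so coeff u e is the multiplicity of X^e in u. *)

abbreviation X :: "nat poly" where "X \<equiv> [:0, 1:]"

(* wt(u), each X^e being represented by its exponent e; the largest exponent comes first. *)
definition wt :: "nat poly \<Rightarrow> nat list" where
  "wt u = concat (map (\<lambda>e. replicate (coeff u e) e) (rev [0..<Suc (degree u)]))"

(* lexord makes a proper prefix smaller. *)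
definition rig_less :: "nat poly \<Rightarrow> nat poly \<Rightarrow> bool" (infix "\<prec>" 50) where
  "u \<prec> v \<longleftrightarrow> (wt u, wt v) \<in> lexord {(m, n). m < n}"

lemma count_list_replicate': "count_list (replicate k e) n = (if n = e then k else 0)"
  by (induction k) auto

lemma count_list_concat_replicate:
  "distinct es \<Longrightarrow>
    count_list (concat (map (\<lambda>e. replicate (c e) e) es)) n = (if n \<in> set es then c n else 0)"
  by (induction es) (auto simp: count_list_replicate')

lemma count_list_wt: "count_list (wt u) e = coeff u e"
  unfolding wt_def
  by (subst count_list_concat_replicate) (auto simp: coeff_eq_0)

lemma coeff_X_power: "coeff (X ^ e) n = (if n = e then 1 else 0)"
  by (metis (no_types) coeff_monom monom_altdef smult_1_left)

lemma sum_list_wt: "(\<Sum>e\<leftarrow>wt u. X ^ e) = u"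
proof (rule poly_eqI)
  fix n
  have "coeff (\<Sum>e\<leftarrow>es. X ^ e) n = count_list es n" for es :: "nat list"
    by (induction es) (simp_all add: coeff_X_power del: One_nat_def)
  then show "coeff (\<Sum>e\<leftarrow>wt u. X ^ e) n = coeff u n"
    by (simp add: count_list_wt)
qed

lemma rig_less_irrefl: "\<not> u \<prec> u"
  unfolding rig_less_def by (rule lexord_irreflexive) auto

lemma rig_less_trans: "u \<prec> v \<Longrightarrow> v \<prec> w \<Longrightarrow> u \<prec> w"
  unfolding rig_less_def by (rule lexord_trans) (auto intro: transI)

lemma rig_less_total: "u \<prec> v \<or> u = v \<or> v \<prec> u"
proof -
  have "wt u = wt v \<Longrightarrow> u = v"
    by (metis sum_list_wt)
  then show ?thesis
    unfolding rig_less_def using lexord_linear[of "{(m, n). m < n}" "wt u" "wt v"]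
    by (metis (mono_tags, lifting) case_prodI linorder_neqE_nat mem_Collect_eq)
qed

(* kRig[x] is "nat poly \<Rightarrow>\<^sub>0 'k". The library multiplication of poly_mapping is convolution along +
   on the keys, i.e. the bilinear extension of circ; see mon_times below. *)

abbreviation mon :: "nat poly \<Rightarrow> nat poly \<Rightarrow>\<^sub>0 'k::field" where
  "mon u \<equiv> Poly_Mapping.single u 1"

definition kscale :: "'k::field \<Rightarrow> (nat poly \<Rightarrow>\<^sub>0 'k) \<Rightarrow> nat poly \<Rightarrow>\<^sub>0 'k" where
  "kscale c f = Poly_Mapping.map ((*) c) f"

(* the bilinear extension of cdot *)
definition kdot :: "(nat poly \<Rightarrow>\<^sub>0 'k::field) \<Rightarrow> (nat poly \<Rightarrow>\<^sub>0 'k) \<Rightarrow> nat poly \<Rightarrow>\<^sub>0 'k"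
    (infixl "\<odot>" 70) where
  "f \<odot> g = (\<Sum>u\<in>Poly_Mapping.keys f. \<Sum>v\<in>Poly_Mapping.keys g.
     Poly_Mapping.single (u * v) (Poly_Mapping.lookup f u * Poly_Mapping.lookup g v))"

lemma mon_times: "(mon u * mon v :: nat poly \<Rightarrow>\<^sub>0 'k::field) = mon (u + v)"
  by (simp add: mult_single)

lemma mon_kdot: "(mon u \<odot> mon v :: nat poly \<Rightarrow>\<^sub>0 'k::field) = mon (u * v)"
  by (simp add: kdot_def)

definition is_ideal :: "(nat poly \<Rightarrow>\<^sub>0 'k::field) set \<Rightarrow> bool" where
  "is_ideal I \<longleftrightarrow> 0 \<in> I \<and> (\<forall>f\<in>I. \<forall>g\<in>I. f + g \<in> I) \<and> (\<forall>c. \<forall>f\<in>I. kscale c f \<in> I) \<and>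
     (\<forall>f\<in>I. \<forall>g. f * g \<in> I) \<and> (\<forall>f\<in>I. \<forall>g. f \<odot> g \<in> I)"

definition Idl :: "(nat poly \<Rightarrow>\<^sub>0 'k::field) set \<Rightarrow> (nat poly \<Rightarrow>\<^sub>0 'k) set" where
  "Idl S = is_ideal hull S"

(* the polynomial u - v identified with the relation u = v *)
definition rel :: "nat poly \<Rightarrow> nat poly \<Rightarrow> nat poly \<Rightarrow>\<^sub>0 'k::field" (infix "\<doteq>" 50) where
  "(u \<doteq> v) = mon u - mon v"

definition lead :: "(nat poly \<Rightarrow>\<^sub>0 'k::field) \<Rightarrow> nat poly" where
  "lead f = (THE u. u \<in> Poly_Mapping.keys f \<and> (\<forall>v\<in>Poly_Mapping.keys f. v \<noteq> u \<longrightarrow> v \<prec> u))"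

definition monic :: "(nat poly \<Rightarrow>\<^sub>0 'k::field) \<Rightarrow> bool" where
  "monic f \<longleftrightarrow> f \<noteq> 0 \<and> Poly_Mapping.lookup f (lead f) = 1"

(* Subtraction on "nat poly" is truncated and coefficientwise, so v - u is the part
   v_{m+1} circ ... circ v_t of v left after removing the part shared with u. *)
definition lcm_circ :: "nat poly \<Rightarrow> nat poly \<Rightarrow> nat poly" where
  "lcm_circ u v = u + (v - u)"

(* "composition f g w h": h is a composition (f,g)_w. X^p and X^q are the chosen factors u_i of
   the leading monomial of f and v_j of that of g; their least common multiple in [x] is
   X^(max p q) = X^a * X^p = X^b * X^q. *)
definition composition ::
    "(nat poly \<Rightarrow>\<^sub>0 'k::field) \<Rightarrow> (nat poly \<Rightarrow>\<^sub>0 'k) \<Rightarrow> nat poly \<Rightarrow> (nat poly \<Rightarrow>\<^sub>0 'k) \<Rightarrow> bool" where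
  "composition f g w h \<longleftrightarrow>
     (\<exists>p\<in>set (wt (lead f)). \<exists>q\<in>set (wt (lead g)). \<exists>a b u v.
        a + p = max p q \<and> b + q = max p q \<and>
        w = lcm_circ (X ^ a * lead f) (X ^ b * lead g) \<and>
        w = X ^ a * lead f + u \<and> w = X ^ b * lead g + v \<and>
        h = (mon (X ^ a) \<odot> f) * mon u - (mon (X ^ b) \<odot> g) * mon v)"

definition trivial_mod ::
    "(nat poly \<Rightarrow>\<^sub>0 'k::field) set \<Rightarrow> nat poly \<Rightarrow> (nat poly \<Rightarrow>\<^sub>0 'k) \<Rightarrow> bool" where
  "trivial_mod S w h \<longleftrightarrow>
     (\<exists>(N::nat) \<alpha> a s u.
        h = (\<Sum>i<N. kscale (\<alpha> i) ((mon (X ^ a i) \<odot> s i) * mon (u i))) \<and>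
        (\<forall>i<N. s i \<in> S \<and> X ^ a i * lead (s i) + u i \<prec> w))"

definition GS_basis :: "(nat poly \<Rightarrow>\<^sub>0 'k::field) set \<Rightarrow> bool" where
  "GS_basis S \<longleftrightarrow> (\<forall>f\<in>S. monic f) \<and>
     (\<forall>f\<in>S. \<forall>g\<in>S. \<forall>w h. composition f g w h \<longrightarrow> trivial_mod S w h)"

end

theory Submission
  imports Defs
begin

text \<open>All relations involved are binomials \<open>l \<doteq> r\<close> with \<open>r \<prec> l\<close>, so they can be read as rewriting
  rules \<open>X\<^sup>a \<cdot> l + t \<rightarrow> X\<^sup>a \<cdot> r + t\<close> on monomials. A composition is the difference of the two results
  of rewriting one monomial \<open>w\<close> in two ways, and it is trivial modulo \<open>w\<close> as soon as these two
  results rewrite to a common monomial (\<open>GS_basis_if_joinable\<close>). Only confluence remains.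

  Confluence is obtained from an invariant, without inspecting critical pairs. Each relation
  becomes an identity of Gaussian integers when \<open>X\<close> is evaluated at \<open>\<i>\<close>, because
  \<open>1 + \<i>\<^sup>2 = 0\<close>, and both of its sides are nonconstant. The rules terminate, and the nonconstant
  irreducible monomials represent each Gaussian integer at most once: exponents \<open>0\<close> and \<open>2\<close> carry
  the positive and negative real part, exponents \<open>1\<close> and \<open>3\<close> the imaginary part, and the rules
  leave essentially no room for cancellation. Hence nonconstant monomials with equal value at
  \<open>\<i>\<close> have the same normal form (\<open>joinable_if_value_at_i_eq\<close>).

  For the equality of ideals, \<open>X = 1 + X + X\<^sup>2\<close> is the rule with \<open>n = 1\<close> read
  from right to left. Conversely, put
  \<open>z = 1 + X\<^sup>2\<close>. The relation \<open>X = X + z\<close> says that \<open>X\<close> absorbs \<open>z\<close>; it forces \<open>X \<cdot> z = z\<close>, so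
  every positive power of \<open>X\<close> absorbs \<open>z\<close>, and all the rules follow (\<open>ideal_contains_rules\<close>).\<close>

(* Rewriting 1 to Suc 0 would turn X into [:0, Suc 0:], which the lemmas about X do not match. *)
declare One_nat_def [simp del]

section \<open>The monomial ordering\<close>

lemma coeff_X_power_times: "coeff (X ^ a * u) n = (if a \<le> n then coeff u (n - a) else 0)"
proof -
  have "X ^ a = monom 1 a"
    by (metis monom_altdef smult_1_left)
  then show ?thesis
    by (simp add: coeff_monom_mult)
qed

lemma wt_conv_bound:
  assumes "degree u < m"
  shows "wt u = concat (map (\<lambda>e. replicate (coeff u e) e) (rev [0..<m]))"
proof -
  have "[0..<m] = [0..<Suc (degree u)] @ [Suc (degree u)..<m]"
    using assms upt_add_eq_append[of 0 "Suc (degree u)" "m - Suc (degree u)"] by simp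
  moreover have "concat (map (\<lambda>e. replicate (coeff u e) e) (rev [Suc (degree u)..<m])) = []"
    by (auto simp: coeff_eq_0)
  ultimately show ?thesis
    by (simp add: wt_def)
qed

lemma rig_less_if_coeff_less:
  assumes less: "coeff u e < coeff v e" and eq: "\<And>n. e < n \<Longrightarrow> coeff u n = coeff v n"
  shows "u \<prec> v"
proof -
  define part where "part p es = concat (map (\<lambda>e. replicate (coeff p e) e) (rev es))"
    for p :: "nat poly" and es
  define m where "m = Suc (max e (max (degree u) (degree v)))"
  have "e < m"
    by (simp add: m_def)
  then have "[0..<m] = [0..<e] @ e # [Suc e..<m]"
    using upt_add_eq_append[of 0 e "m - e"] by (simp add: upt_conv_Cons)
  then have split: "wt p = part p [Suc e..<m] @ replicate (coeff p e) e @ part p [0..<e]"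
    if "degree p < m" for p
    using wt_conv_bound[OF that] by (simp add: part_def)
  have deg: "degree u < m" "degree v < m"
    by (simp_all add: m_def)
  have high: "part u [Suc e..<m] = part v [Suc e..<m]"
    unfolding part_def by (rule arg_cong[where f = concat]) (auto intro!: map_cong simp: eq)
  (* Behind the common prefix, the weight of u has only exponents below e, or is exhausted,
     whereas that of v still has a copy of e. *)
  obtain d where d: "coeff v e = coeff u e + Suc d"
    using less less_iff_Suc_add by auto
  have "(part u [0..<e], replicate (Suc d) e @ part v [0..<e]) \<in> lexord {(m, n). m < n}"
  proof (cases "part u [0..<e]")
    case (Cons x xs)
    then have "x \<in> set (part u [0..<e])"
      by simp
    then have "x < e"
      by (auto simp: part_def)
    then show ?thesis
      by (simp add: Cons)
  qed simp
  then show ?thesis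
    unfolding rig_less_def split[OF deg(1)] split[OF deg(2)] high d replicate_add append_assoc
    by (intro lexord_append_leftI)
qed

text \<open>The weight lists occurrences of powers from the largest exponent downwards, so the first
  difference between two weights is met at the largest exponent whose multiplicities differ.\<close>

lemma rig_less_iff_coeff:
  "u \<prec> v \<longleftrightarrow> (\<exists>e. coeff u e < coeff v e \<and> (\<forall>n>e. coeff u n = coeff v n))"
proof
  assume "u \<prec> v"
  then have "u \<noteq> v"
    using rig_less_irrefl by auto
  then have "{e. coeff u e \<noteq> coeff v e} \<noteq> {}"
    by (auto simp: poly_eq_iff)
  moreover have "finite {e. coeff u e \<noteq> coeff v e}"
    by (rule finite_subset[of _ "{..max (degree u) (degree v)}"])
      (auto simp: coeff_eq_0 not_le intro: leI ccontr)
  ultimately obtain e where "coeff u e \<noteq> coeff v e" and above: "\<forall>n>e. coeff u n = coeff v n"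
    by (metis (mono_tags, lifting) Max_in Max_ge leD mem_Collect_eq)
  moreover have "\<not> coeff v e < coeff u e"
    using rig_less_if_coeff_less[of v e u] above \<open>u \<prec> v\<close> rig_less_trans rig_less_irrefl by metis
  ultimately show "\<exists>e. coeff u e < coeff v e \<and> (\<forall>n>e. coeff u n = coeff v n)"
    by (meson linorder_neqE_nat)
qed (auto intro: rig_less_if_coeff_less)

lemma rig_less_add_right: "u \<prec> v \<Longrightarrow> u + t \<prec> v + t"
  by (auto simp: rig_less_iff_coeff)

lemma rig_less_X_power_times:
  assumes "u \<prec> v"
  shows "X ^ a * u \<prec> X ^ a * v"
proof -
  obtain e where "coeff u e < coeff v e" "\<forall>n>e. coeff u n = coeff v n"
    using assms by (auto simp: rig_less_iff_coeff)
  then show ?thesis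
    by (intro rig_less_if_coeff_less[of _ "e + a"]) (auto simp: coeff_X_power_times)
qed

section \<open>Relations as polynomials\<close>

lemma keys_rel:
  assumes "u \<noteq> v"
  shows "Poly_Mapping.keys (u \<doteq> v :: nat poly \<Rightarrow>\<^sub>0 'k::field) = {u, v}"
  using assms by (auto simp: rel_def in_keys_iff lookup_minus lookup_single when_def split: if_splits)

lemma lead_rel:
  assumes "v \<prec> u"
  shows "lead (u \<doteq> v :: nat poly \<Rightarrow>\<^sub>0 'k::field) = u"
proof -
  have "u \<noteq> v" and "\<not> u \<prec> v"
    using assms rig_less_irrefl rig_less_trans by metis+
  then show ?thesis
    unfolding lead_def keys_rel[OF \<open>u \<noteq> v\<close>] using assms by (intro the_equality) auto
qed

lemma monic_rel:
  assumes "v \<prec> u"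
  shows "monic (u \<doteq> v :: nat poly \<Rightarrow>\<^sub>0 'k::field)"
proof -
  have "u \<noteq> v"
    using assms rig_less_irrefl by auto
  then have "Poly_Mapping.lookup (u \<doteq> v :: nat poly \<Rightarrow>\<^sub>0 'k) u = 1"
    by (simp add: rel_def lookup_minus lookup_single when_def)
  moreover from this have "(u \<doteq> v :: nat poly \<Rightarrow>\<^sub>0 'k) \<noteq> 0"
    by auto
  ultimately show ?thesis
    by (simp add: monic_def lead_rel[OF assms])
qed

lemma mon_kdot_rel: "mon a \<odot> (u \<doteq> v) = (a * u \<doteq> a * v :: nat poly \<Rightarrow>\<^sub>0 'k::field)"
proof (cases "u = v")
  case False
  then show ?thesis
    unfolding kdot_def keys_rel[OF False]
    by (simp add: rel_def lookup_minus lookup_single when_def single_uminus)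
qed (simp add: kdot_def rel_def)

lemma rel_kdot_mon: "(u \<doteq> v) \<odot> mon a = (u * a \<doteq> v * a :: nat poly \<Rightarrow>\<^sub>0 'k::field)"
proof (cases "u = v")
  case False
  then show ?thesis
    unfolding kdot_def keys_rel[OF False]
    by (simp add: rel_def lookup_minus lookup_single when_def single_uminus)
qed (simp add: kdot_def rel_def)

lemma rel_times_mon: "(u \<doteq> v) * mon t = (u + t \<doteq> v + t :: nat poly \<Rightarrow>\<^sub>0 'k::field)"
  by (simp add: rel_def left_diff_distrib mon_times)

lemma kscale_1: "kscale 1 f = f"
  by (rule poly_mapping_eqI) (simp add: kscale_def map.rep_eq when_def)

lemma kscale_minus_1: "kscale (- 1) f = - f"
  by (rule poly_mapping_eqI) (simp add: kscale_def map.rep_eq when_def)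

section \<open>Rewriting steps and triviality\<close>

definition rewrite_step :: "(nat poly \<times> nat poly) set \<Rightarrow> nat poly \<Rightarrow> nat poly \<Rightarrow> bool" where
  "rewrite_step R u v \<longleftrightarrow>
     (\<exists>(l, r)\<in>R. \<exists>a t. u = X ^ a * l + t \<and> v = X ^ a * r + t)"

lemma rewrite_step_less:
  assumes "\<forall>(l, r)\<in>R. r \<prec> l" "rewrite_step R u v"
  shows "v \<prec> u"
  using assms by (auto simp: rewrite_step_def intro!: rig_less_add_right rig_less_X_power_times)

lemma trivial_mod_0: "trivial_mod S w 0"
  unfolding trivial_mod_def by (rule exI[of _ 0]) simp

lemma trivial_mod_add_term:
  assumes "trivial_mod S w h" "s \<in> S" "X ^ a * lead s + u \<prec> w"
  shows "trivial_mod S w (h + kscale c ((mon (X ^ a) \<odot> s) * mon u))"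
proof -
  obtain N :: nat and \<alpha> b t v where
    h: "h = (\<Sum>i<N. kscale (\<alpha> i) ((mon (X ^ b i) \<odot> t i) * mon (v i)))"
    and less: "\<forall>i<N. t i \<in> S \<and> X ^ b i * lead (t i) + v i \<prec> w"
    using assms(1) unfolding trivial_mod_def by blast
  have "h + kscale c ((mon (X ^ a) \<odot> s) * mon u) =
      (\<Sum>i<Suc N. kscale ((\<alpha>(N := c)) i)
        ((mon (X ^ (b(N := a)) i) \<odot> (t(N := s)) i) * mon ((v(N := u)) i)))"
    by (simp add: h)
  moreover have "\<forall>i<Suc N. (t(N := s)) i \<in> S \<and>
      X ^ (b(N := a)) i * lead ((t(N := s)) i) + (v(N := u)) i \<prec> w"
    using less assms(2,3) by (auto simp: less_Suc_eq)
  ultimately show ?thesis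
    unfolding trivial_mod_def by blast
qed

text \<open>A rewriting step from a monomial below \<open>w\<close> contributes exactly one summand of a
  representation modulo \<open>w\<close>, since its left-hand side is the leading monomial of that summand.\<close>

lemma trivial_mod_add_step:
  fixes h :: "nat poly \<Rightarrow>\<^sub>0 'k::field"
  assumes R: "\<forall>(l, r)\<in>R. r \<prec> l" and S: "S = {l \<doteq> r | l r. (l, r) \<in> R}"
    and h: "trivial_mod S w h" and step: "rewrite_step R u v" and "u \<prec> w"
  shows "trivial_mod S w (h + (u \<doteq> v))" "trivial_mod S w (h - (u \<doteq> v))"
proof -
  obtain l r a t where lr: "(l, r) \<in> R" and u: "u = X ^ a * l + t" and v: "v = X ^ a * r + t"
    using step by (auto simp: rewrite_step_def)
  have lead: "lead (l \<doteq> r :: nat poly \<Rightarrow>\<^sub>0 'k) = l"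
    using lr R by (auto intro: lead_rel)
  have "trivial_mod S w (h + kscale c (mon (X ^ a) \<odot> (l \<doteq> r) * mon t))" for c
    by (rule trivial_mod_add_term[OF h]) (use lr \<open>u \<prec> w\<close> in \<open>auto simp: S lead u\<close>)
  from this[of 1] this[of "- 1"]
  show "trivial_mod S w (h + (u \<doteq> v))" "trivial_mod S w (h - (u \<doteq> v))"
    by (simp_all add: mon_kdot_rel rel_times_mon kscale_1 kscale_minus_1 u v)
qed

text \<open>Telescoping along the two rewriting sequences works because rewriting descends: every
  monomial on the way stays below \<open>w\<close>.\<close>

lemma trivial_mod_rel_if_joinable:
  fixes S :: "(nat poly \<Rightarrow>\<^sub>0 'k::field) set"
  assumes R: "\<forall>(l, r)\<in>R. r \<prec> l" and S: "S = {l \<doteq> r | l r. (l, r) \<in> R}"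
    and "(rewrite_step R)\<^sup>*\<^sup>* u n" "(rewrite_step R)\<^sup>*\<^sup>* v n" "u \<prec> w" "v \<prec> w"
  shows "trivial_mod S w (u \<doteq> v)"
proof -
  have "trivial_mod S w (n \<doteq> v)"
    using assms(4,6)
  proof (induction rule: converse_rtranclp_induct)
    case base
    then show ?case
      by (simp add: rel_def trivial_mod_0)
  next
    case (step v v')
    then have "trivial_mod S w (n \<doteq> v')"
      using rewrite_step_less[OF R] rig_less_trans by blast
    then have "trivial_mod S w ((n \<doteq> v') - (v \<doteq> v'))"
      using step by (intro trivial_mod_add_step[OF R S])
    then show ?case
      by (simp add: rel_def)
  qed
  with assms(3,5) show ?thesis
  proof (induction rule: converse_rtranclp_induct)
    case (step u u')
    then have "trivial_mod S w (u' \<doteq> v)"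
      using rewrite_step_less[OF R] rig_less_trans by blast
    then have "trivial_mod S w ((u' \<doteq> v) + (u \<doteq> u'))"
      using step by (intro trivial_mod_add_step[OF R S])
    then show ?case
      by (simp add: rel_def)
  qed
qed

text \<open>In a composition of two binomials the common monomial \<open>w\<close> cancels. What remains is the
  difference of the two monomials obtained from \<open>w\<close> by rewriting with either rule, so local
  confluence is all that is needed.\<close>

lemma GS_basis_if_joinable:
  fixes S :: "(nat poly \<Rightarrow>\<^sub>0 'k::field) set"
  assumes R: "\<forall>(l, r)\<in>R. r \<prec> l" and S: "S = {l \<doteq> r | l r. (l, r) \<in> R}"
    and join: "\<And>w u v. rewrite_step R w u \<Longrightarrow> rewrite_step R w v \<Longrightarrow>
      \<exists>n. (rewrite_step R)\<^sup>*\<^sup>* u n \<and> (rewrite_step R)\<^sup>*\<^sup>* v n"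
  shows "GS_basis S"
  unfolding GS_basis_def
proof (intro conjI ballI allI impI)
  fix f assume "f \<in> S"
  then show "monic f"
    using R by (auto simp: S intro: monic_rel)
next
  fix f g w h
  assume "f \<in> S" "g \<in> S" and comp: "composition f g w h"
  then obtain l r l' r' where f: "f = (l \<doteq> r)" "(l, r) \<in> R" and g: "g = (l' \<doteq> r')" "(l', r') \<in> R"
    by (auto simp: S)
  have lead: "lead f = l" "lead g = l'"
    using R f g by (auto intro: lead_rel)
  obtain a b t t' where w: "w = X ^ a * l + t" "w = X ^ b * l' + t'"
    and h: "h = mon (X ^ a) \<odot> f * mon t - mon (X ^ b) \<odot> g * mon t'"
    using comp unfolding composition_def lead by blast
  define u v where "u = X ^ b * r' + t'" and "v = X ^ a * r + t"
  have steps: "rewrite_step R w u" "rewrite_step R w v"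
    using f(2) g(2) w unfolding rewrite_step_def u_def v_def by blast+
  have "h = (w \<doteq> v) - (w \<doteq> u)"
    unfolding h f g mon_kdot_rel rel_times_mon u_def v_def using w by simp
  then have "h = (u \<doteq> v)"
    by (simp add: rel_def)
  moreover have "u \<prec> w" "v \<prec> w"
    using steps rewrite_step_less[OF R] by auto
  ultimately show "trivial_mod S w h"
    using join[OF steps] trivial_mod_rel_if_joinable[OF R S] by blast
qed

section \<open>Normal forms of the rewriting system\<close>

definition rules :: "(nat poly \<times> nat poly) set" where
  "rules = {(X ^ 4, 1 + 1 + X ^ 2), (X + X ^ 3, 1 + X ^ 2)} \<union>
     {(1 + X ^ 2 + X ^ n, X ^ n) | n. 1 \<le> n \<and> n \<le> 3}"

lemma rules_conv:
  "rules = {([:0, 0, 0, 0, 1:], [:2, 0, 1:]), ([:0, 1, 0, 1:], [:1, 0, 1:]),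
     ([:1, 1, 1:], [:0, 1:]), ([:1, 0, 2:], [:0, 0, 1:]), ([:1, 0, 1, 1:], [:0, 0, 0, 1:])}"
proof -
  have "{n. 1 \<le> n \<and> n \<le> 3} = {1, 2, 3 :: nat}"
    by auto
  then have "{(1 + X ^ 2 + X ^ n, X ^ n) | n. 1 \<le> n \<and> n \<le> 3} =
      (\<lambda>n. (1 + X ^ 2 + X ^ n, X ^ n)) ` {1, 2, 3}"
    by blast
  moreover have "X ^ 2 = [:0, 0, 1:]" "X ^ 3 = [:0, 0, 0, 1:]" "X ^ 4 = [:0, 0, 0, 0, 1:]"
    by (simp_all add: power2_eq_square power3_eq_cube power4_eq_xxxx)
  ultimately show ?thesis
    by (simp add: rules_def one_pCons insert_commute)
qed

lemma rules_decreasing: "\<forall>(l, r)\<in>rules. r \<prec> l"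
proof -
  have "[:2, 0, 1:] \<prec> [:0, 0, 0, 0, 1:]"
    by (rule rig_less_if_coeff_less[of _ 4]) (auto simp: coeff_pCons split: nat.split)
  moreover have "[:1, 0, 1:] \<prec> [:0, 1, 0, 1:]"
    by (rule rig_less_if_coeff_less[of _ 3]) (auto simp: coeff_pCons split: nat.split)
  moreover have "[:0, 1:] \<prec> [:1, 1, 1:]" "[:0, 0, 1:] \<prec> [:1, 0, 2:]"
    "[:0, 0, 0, 1:] \<prec> [:1, 0, 1, 1:]"
    by (rule rig_less_if_coeff_less[of _ 2]; auto simp: coeff_pCons split: nat.split)+
  ultimately show ?thesis
    by (auto simp: rules_conv)
qed

definition value_at_i :: "nat poly \<Rightarrow> complex" where
  "value_at_i u = poly (map_poly of_nat u) \<i>"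

lemma value_at_i_pCons [simp]: "value_at_i (pCons c u) = of_nat c + \<i> * value_at_i u"
  by (simp add: value_at_i_def map_poly_pCons)

lemma value_at_i_0 [simp]: "value_at_i 0 = 0"
  by (simp add: value_at_i_def)

lemma value_at_i_add: "value_at_i (u + v) = value_at_i u + value_at_i v"
proof -
  have "map_poly of_nat (u + v) = (map_poly of_nat u + map_poly of_nat v :: complex poly)"
    by (rule poly_eqI) (simp add: coeff_map_poly)
  then show ?thesis
    by (simp add: value_at_i_def)
qed

lemma value_at_i_X_power_times: "value_at_i (X ^ a * u) = \<i> ^ a * value_at_i u"
  by (induction a) (simp_all add: mult.assoc)

lemma value_at_i_rewrite_step:
  assumes "rewrite_step rules u v"
  shows "value_at_i u = value_at_i v"
proof -
  have "value_at_i l = value_at_i r" if "(l, r) \<in> rules" for l r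
    using that by (auto simp: rules_conv algebra_simps)
  then show ?thesis
    using assms by (auto simp: rewrite_step_def value_at_i_add value_at_i_X_power_times)
qed

text \<open>Constants must be kept apart from the other monomials, since for instance \<open>2\<close> and
  \<open>2 + X + X\<^sup>3\<close> agree at \<open>\<i>\<close> but are not related. Right-hand sides are nonconstant, so a
  rewriting step never leads to a constant.\<close>

lemma degree_pos_rewrite_step:
  assumes "rewrite_step rules u v"
  shows "0 < degree v"
proof -
  obtain l r a t where lr: "(l, r) \<in> rules" and v: "v = X ^ a * r + t"
    using assms by (auto simp: rewrite_step_def)
  obtain e where "0 < e" "coeff r e \<noteq> 0"
  proof -
    have "0 < degree r"
      using lr by (auto simp: rules_conv)
    then show ?thesis
      using that by (metis degree_0 leading_coeff_0_iff not_gr_zero)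
  qed
  then have "coeff v (a + e) \<noteq> 0"
    by (simp add: v coeff_X_power_times)
  then show ?thesis
    using le_degree[of v "a + e"] \<open>0 < e\<close> by linarith
qed

text \<open>Evaluation at \<open>2\<close> is a termination measure: the rules decrease it from 16 to 6, 10 to 5,
  7 to 2, 9 to 4 and 13 to 8, and the context \<open>X\<^sup>a \<cdot> _ + t\<close> is strictly monotone.\<close>

lemma poly_2_rewrite_step:
  assumes "rewrite_step rules u v"
  shows "poly v 2 < poly u 2"
proof -
  have "poly r 2 < poly l 2" if "(l, r) \<in> rules" for l r
    using that by (auto simp: rules_conv)
  then show ?thesis
    using assms by (auto simp: rewrite_step_def poly_power)
qed

lemma normal_form_exists:
  "\<exists>n. (rewrite_step rules)\<^sup>*\<^sup>* u n \<and> (\<nexists>v. rewrite_step rules n v)"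
proof (induction "poly u 2" arbitrary: u rule: less_induct)
  case less
  then show ?case
    by (metis converse_rtranclp_into_rtranclp poly_2_rewrite_step rtranclp.rtrancl_refl)
qed

text \<open>A monomial that contains a multiple \<open>X\<^sup>a \<cdot> l\<close> of a left-hand side can be rewritten there, the
  truncated difference being the remaining context.\<close>

lemma irreducible_not_above:
  assumes "\<nexists>v. rewrite_step R u v" "(l, r) \<in> R"
  shows "\<exists>e. coeff u e < coeff (X ^ a * l) e"
proof (rule ccontr)
  assume "\<not> ?thesis"
  then have "u = X ^ a * l + (u - X ^ a * l)"
    by (intro poly_eqI) (simp add: not_less)
  then have "rewrite_step R u (X ^ a * r + (u - X ^ a * l))"
    using assms(2) unfolding rewrite_step_def by blast
  with assms(1) show False
    by blast
qed

lemma irreducible_coeffs: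
  assumes "\<nexists>v. rewrite_step rules u v"
  obtains c0 c1 c2 c3 where "u = [:c0, c1, c2, c3:]" "c1 = 0 \<or> c3 = 0"
    "c0 = 0 \<or> c2 = 0 \<or> c1 = 0 \<and> c2 = 1 \<and> c3 = 0"
proof
  have zero: "coeff u n = 0" if "4 \<le> n" for n
  proof -
    have "\<exists>e. coeff u e < coeff (X ^ (n - 4) * [:0, 0, 0, 0, 1:]) e"
      using assms by (rule irreducible_not_above) (auto simp: rules_conv)
    moreover have "X ^ (n - 4) * [:0, 0, 0, 0, 1:] = X ^ n"
    proof -
      have "[:0, 0, 0, 0, 1:] = X ^ 4"
        by (simp add: power4_eq_xxxx)
      then show ?thesis
        using that by (metis le_add_diff_inverse2 power_add)
    qed
    ultimately show ?thesis
      by (metis coeff_X_power less_one not_less_zero)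
  qed
  show "u = [:coeff u 0, coeff u 1, coeff u 2, coeff u 3:]"
    by (rule poly_eqI) (auto simp: coeff_pCons eval_nat_numeral One_nat_def intro!: zero split: nat.split)
  have below: "coeff u 0 < b0 \<or> coeff u 1 < b1 \<or> coeff u 2 < b2 \<or> coeff u 3 < b3"
    if rule: "([:b0, b1, b2, b3:], r) \<in> rules" for b0 b1 b2 b3 r
  proof -
    obtain e where e: "coeff u e < coeff [:b0, b1, b2, b3:] e"
      using irreducible_not_above[OF assms rule, of 0] by auto
    then have "e \<le> degree [:b0, b1, b2, b3:]"
      by (intro le_degree) linarith
    also have "\<dots> \<le> 3"
      by simp
    finally consider "e = 0" | "e = 1" | "e = 2" | "e = 3"
      by linarith
    then show ?thesis
      using e by cases (auto simp: numeral_2_eq_2 numeral_3_eq_3 One_nat_def)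
  qed
  show "coeff u 1 = 0 \<or> coeff u 3 = 0"
    using below[of 0 1 0 1 "[:1, 0, 1:]"] by (auto simp: rules_conv)
  have "coeff u 0 = 0 \<or> coeff u 1 = 0 \<or> coeff u 2 = 0"
    using below[of 1 1 1 0 "[:0, 1:]"] by (auto simp: rules_conv)
  moreover have "coeff u 0 = 0 \<or> coeff u 2 < 2"
    using below[of 1 0 2 0 "[:0, 0, 1:]"] by (auto simp: rules_conv)
  moreover have "coeff u 0 = 0 \<or> coeff u 2 = 0 \<or> coeff u 3 = 0"
    using below[of 1 0 1 1 "[:0, 0, 0, 1:]"] by (auto simp: rules_conv)
  ultimately show "coeff u 0 = 0 \<or> coeff u 2 = 0 \<or> coeff u 1 = 0 \<and> coeff u 2 = 1 \<and> coeff u 3 = 0"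
    by linarith
qed

text \<open>With multiplicities \<open>c\<^sub>0, \<dots>, c\<^sub>3\<close> the value at \<open>\<i>\<close> is \<open>(c\<^sub>0 - c\<^sub>2) + (c\<^sub>1 - c\<^sub>3) \<i>\<close>. One of
  \<open>c\<^sub>1, c\<^sub>3\<close> is zero, so the imaginary part determines both. One of \<open>c\<^sub>0, c\<^sub>2\<close> is zero, too, except
  for the monomials \<open>c\<^sub>0 + X\<^sup>2\<close> with \<open>c\<^sub>0 > 0\<close>. These stand for the real numbers \<open>c\<^sub>0 - 1\<close>, which
  otherwise only constants would represent.\<close>

lemma irreducible_eq_if_value_at_i_eq:
  assumes "\<nexists>u'. rewrite_step rules u u'" "\<nexists>v'. rewrite_step rules v v'"
    and "0 < degree u" "0 < degree v" "value_at_i u = value_at_i v"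
  shows "u = v"
proof -
  obtain a0 a1 a2 a3 where u: "u = [:a0, a1, a2, a3:]" and ua: "a1 = 0 \<or> a3 = 0"
    "a0 = 0 \<or> a2 = 0 \<or> a1 = 0 \<and> a2 = 1 \<and> a3 = 0"
    using assms(1) by (rule irreducible_coeffs)
  obtain b0 b1 b2 b3 where v: "v = [:b0, b1, b2, b3:]" and vb: "b1 = 0 \<or> b3 = 0"
    "b0 = 0 \<or> b2 = 0 \<or> b1 = 0 \<and> b2 = 1 \<and> b3 = 0"
    using assms(2) by (rule irreducible_coeffs)
  have "a0 + b2 = b0 + a2" "a1 + b3 = b1 + a3"
    using assms(5) by (simp_all add: u v complex_eq_iff flip: of_nat_add)
  moreover have "a1 > 0 \<or> a2 > 0 \<or> a3 > 0" "b1 > 0 \<or> b2 > 0 \<or> b3 > 0"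
    using assms(3,4) by (auto simp: u v split: if_splits)
  ultimately have "a0 = b0 \<and> a1 = b1 \<and> a2 = b2 \<and> a3 = b3"
    using ua vb by auto
  then show ?thesis
    by (simp add: u v)
qed

lemma joinable_if_value_at_i_eq:
  assumes "0 < degree u" "0 < degree v" "value_at_i u = value_at_i v"
  shows "\<exists>n. (rewrite_step rules)\<^sup>*\<^sup>* u n \<and> (rewrite_step rules)\<^sup>*\<^sup>* v n"
proof -
  have invariant: "0 < degree n \<and> value_at_i n = value_at_i p"
    if "(rewrite_step rules)\<^sup>*\<^sup>* p n" "0 < degree p" for p n
    using that by induction (auto simp: value_at_i_rewrite_step dest: degree_pos_rewrite_step)
  obtain n m where n: "(rewrite_step rules)\<^sup>*\<^sup>* u n" "\<nexists>n'. rewrite_step rules n n'"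
    and m: "(rewrite_step rules)\<^sup>*\<^sup>* v m" "\<nexists>m'. rewrite_step rules m m'"
    using normal_form_exists by blast
  have "n = m"
    using n(2) m(2) by (rule irreducible_eq_if_value_at_i_eq) (use invariant n(1) m(1) assms in auto)
  then show ?thesis
    using n(1) m(1) by blast
qed

section \<open>Equality of the two ideals\<close>

lemma ideal_rel_refl: "is_ideal I \<Longrightarrow> (u \<doteq> u) \<in> I"
  by (simp add: is_ideal_def rel_def)

lemma ideal_rel_sym:
  assumes "is_ideal I" "(u \<doteq> v) \<in> I"
  shows "(v \<doteq> u) \<in> I"
proof -
  have "kscale (- 1) (u \<doteq> v) \<in> I"
    using assms unfolding is_ideal_def by blast
  then show ?thesis
    by (simp add: kscale_minus_1 rel_def)
qed

lemma ideal_rel_trans: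
  assumes "is_ideal I" "(u \<doteq> v) \<in> I" "(v \<doteq> w) \<in> I"
  shows "(u \<doteq> w) \<in> I"
proof -
  have "(u \<doteq> v) + (v \<doteq> w) \<in> I"
    using assms unfolding is_ideal_def by blast
  then show ?thesis
    by (simp add: rel_def)
qed

lemma ideal_rel_add:
  assumes "is_ideal I" "(u \<doteq> v) \<in> I"
  shows "(u + t \<doteq> v + t) \<in> I"
  using assms unfolding is_ideal_def by (metis rel_times_mon)

lemma ideal_rel_times:
  assumes "is_ideal I" "(u \<doteq> v) \<in> I"
  shows "(u * t \<doteq> v * t) \<in> I"
  using assms unfolding is_ideal_def by (metis rel_kdot_mon)

text \<open>Modulo the ideal, multiplying \<open>X = X + z\<close> by \<open>X\<^sup>k\<close> gives \<open>X\<^sup>k\<^sup>+\<^sup>1 = X\<^sup>k\<^sup>+\<^sup>1 + X\<^sup>k \<cdot> z\<close>. Once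
  \<open>X \<cdot> z = z\<close> is known, which is the second rule, this becomes \<open>X\<^sup>k\<^sup>+\<^sup>1 = z + X\<^sup>k\<^sup>+\<^sup>1\<close>, the third
  family. The first rule is the chain \<open>X\<^sup>4 = z + X\<^sup>4 = X\<^sup>2 \<cdot> z + 1 = z + 1\<close>.\<close>

lemma ideal_contains_rules:
  assumes I: "is_ideal (I :: (nat poly \<Rightarrow>\<^sub>0 'k::field) set)" and gen: "(X \<doteq> 1 + X + X ^ 2) \<in> I"
    and lr: "(l, r) \<in> rules"
  shows "(l \<doteq> r) \<in> I"
proof -
  define eqv (infix "\<approx>" 50) where "u \<approx> v \<longleftrightarrow> (u \<doteq> v :: nat poly \<Rightarrow>\<^sub>0 'k) \<in> I" for u v
  have sym: "u \<approx> v \<Longrightarrow> v \<approx> u" for u v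
    unfolding eqv_def by (rule ideal_rel_sym[OF I])
  have [trans]: "u \<approx> v \<Longrightarrow> v \<approx> w \<Longrightarrow> u \<approx> w" for u v w
    unfolding eqv_def by (rule ideal_rel_trans[OF I])
  have add: "u + t \<approx> v + t" if "u \<approx> v" for u v t
    using that unfolding eqv_def by (rule ideal_rel_add[OF I])
  have shift: "X ^ k * u \<approx> X ^ k * v" if "u \<approx> v" for u v k
    using ideal_rel_times[OF I that[unfolded eqv_def], of "X ^ k"]
    by (simp add: eqv_def mult.commute)
  define z where "z = 1 + X ^ 2"
  have split: "X ^ Suc k \<approx> X ^ Suc k + X ^ k * z" for k
    using shift[OF gen[folded eqv_def], of k]
    by (simp add: z_def algebra_simps power2_eq_square)
  (* Expanding the X^2 inside z creates an X, which then absorbs 1 + X^2 and leaves X + X^3. *)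
  have "z \<approx> X * z"
  proof -
    have "z \<approx> X ^ 2 + X * z + 1"
      using add[OF split[of 1], of 1] by (simp add: z_def algebra_simps power2_eq_square)
    also have "X ^ 2 + X * z + 1 = (X + X ^ 0 * z) + X ^ 3"
      by (simp add: z_def algebra_simps power2_eq_square power3_eq_cube)
    also have "\<dots> \<approx> X ^ Suc 0 + X ^ 3"
      using add[OF sym[OF split[of 0]], of "X ^ 3"] by simp
    also have "\<dots> = X * z"
      by (simp add: z_def algebra_simps power2_eq_square power3_eq_cube)
    finally show ?thesis .
  qed
  have power: "X ^ k * z \<approx> z" for k
  proof (induction k)
    case 0
    then show ?case
      by (simp add: eqv_def ideal_rel_refl[OF I])
  next
    case (Suc k)
    have "X ^ Suc k * z = X ^ k * (X * z)"
      by (simp add: algebra_simps)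
    also have "\<dots> \<approx> X ^ k * z"
      by (rule shift[OF sym]) fact
    also note Suc
    finally show ?case .
  qed
  have absorb: "X ^ Suc k \<approx> z + X ^ Suc k" for k
  proof -
    note split
    also have "X ^ Suc k + X ^ k * z = X ^ k * z + X ^ Suc k"
      by (rule add.commute)
    also have "\<dots> \<approx> z + X ^ Suc k"
      by (rule add[OF power])
    finally show ?thesis .
  qed
  have "X ^ 4 \<approx> 1 + 1 + X ^ 2"
  proof -
    have "X ^ 4 \<approx> z + X ^ 4"
      using absorb[of 3] by simp
    also have "z + X ^ 4 = X ^ 2 * z + 1"
      by (simp add: z_def algebra_simps flip: power_add)
    also have "\<dots> \<approx> z + 1"
      by (rule add[OF power])
    also have "z + 1 = 1 + 1 + X ^ 2"
      by (simp only: z_def ac_simps)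
    finally show ?thesis .
  qed
  moreover have "X + X ^ 3 \<approx> 1 + X ^ 2"
    using power[of 1] by (simp add: z_def algebra_simps power2_eq_square power3_eq_cube)
  moreover have "1 + X ^ 2 + X ^ n \<approx> X ^ n" if "1 \<le> n" for n
    using sym[OF absorb[of "n - 1"]] that by (simp add: z_def)
  ultimately show ?thesis
    using lr by (auto simp: rules_def eqv_def)
qed

lemma is_ideal_Idl: "is_ideal (Idl S)"
  unfolding Idl_def by (rule hull_in) (auto simp: is_ideal_def)

theorem theorem5p1:
  fixes S :: "(nat poly \<Rightarrow>\<^sub>0 'k::field) set"
  assumes "S = {X ^ 4 \<doteq> 1 + 1 + X ^ 2, X + X ^ 3 \<doteq> 1 + X ^ 2} \<union>
               {1 + X ^ 2 + X ^ n \<doteq> X ^ n | n. 1 \<le> n \<and> n \<le> 3}"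
  shows "Idl {X \<doteq> 1 + X + X ^ 2} = Idl S \<and> GS_basis S"
proof
  have S: "S = {l \<doteq> r | l r. (l, r) \<in> rules}"
    unfolding assms rules_def by blast
  show "Idl {X \<doteq> 1 + X + X ^ 2} = Idl S"
  proof
    have "(1 + X ^ 2 + X ^ 1 \<doteq> X ^ 1) \<in> S"
      unfolding assms by (intro UnI2 CollectI exI[of _ 1]) simp
    then have "(1 + X ^ 2 + X ^ 1 \<doteq> X ^ 1) \<in> Idl S"
      unfolding Idl_def by (rule hull_inc)
    then have "(X \<doteq> 1 + X + X ^ 2) \<in> Idl S"
      by (auto dest: ideal_rel_sym[OF is_ideal_Idl] simp: ac_simps)
    then show "Idl {X \<doteq> 1 + X + X ^ 2} \<subseteq> Idl S"
      unfolding Idl_def[of "{_}"] by (intro hull_minimal) (auto simp: is_ideal_Idl)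
  next
    have "(X \<doteq> 1 + X + X ^ 2) \<in> Idl {X \<doteq> 1 + X + X ^ 2 :: nat poly \<Rightarrow>\<^sub>0 'k}"
      unfolding Idl_def by (rule hull_inc) simp
    then have "S \<subseteq> Idl {X \<doteq> 1 + X + X ^ 2}"
      using ideal_contains_rules[OF is_ideal_Idl] by (auto simp: S)
    then show "Idl S \<subseteq> Idl {X \<doteq> 1 + X + X ^ 2}"
      unfolding Idl_def[of S] by (intro hull_minimal is_ideal_Idl)
  qed
  show "GS_basis S"
  proof (rule GS_basis_if_joinable[OF rules_decreasing S])
    fix w u v
    assume "rewrite_step rules w u" "rewrite_step rules w v"
    then show "\<exists>n. (rewrite_step rules)\<^sup>*\<^sup>* u n \<and> (rewrite_step rules)\<^sup>*\<^sup>* v n"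
      by (metis degree_pos_rewrite_step joinable_if_value_at_i_eq value_at_i_rewrite_step)
  qed
qed

end
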